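(* Let $G,H$ be graphs. The number of $M$-tension-continuous mappings $E(G)\to E(H)$, where $M$ ranges over finitely generated abelian groups, depends only on $n(M)$: if $M,N$ are finitely generated abelian groups with $n(M)=n(N)$, then the number of $M$-tension-continuous mappings from $G$ to $H$ equals the number of $N$-tension-continuous mappings from $G$ to $H$.
   Context: Graphs are finite directed graphs. For a circuit $C$ of the underlying undirected graph, $C^+$ and $C^-$ denote the sets of its edges oriented in each of the two directions around $C$. For an abelian group $M$, an $M$-tension on $G$ is a function $\tau:E(G)\to M$ such that $\sum_{e\in C^+}\tau(e)=\sum_{e\in C^-}\tau(e)$ for every circuit $C$ of $G$. A mapping $f:E(G)\to E(H)$ is $M$-tension-continuous if for every $M$-tension $\tau$ on $H$ the composition $\tau\circ f$ is an $M$-tension on $G$. For a finitely generated abelian group $M\simeq\mathbb Z^{\alpha}\times\prod_{i=1}^k\mathbb Z_{n_i}^{\beta_i}$ (with $\alpha\ge 0$, $n_i,\beta_i\ge1$), put $n(M)=\infty$ if $\alpha>0$, and otherwise let $n(M)$ be the least common multiple of $n_1,\dots,n_k$. *)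

theory Defs
  imports
    "Graph_Theory.Digraph"
    "Graph_Theory.Arc_Walk"
    "HOL-Algebra.FiniteProduct"
    "HOL-Algebra.Generated_Groups"
    "HOL-Algebra.Product_Groups"
    "HOL-Library.Extended_Nat"
begin

section \<open>Circuits of the underlying undirected graph\<close>

text \<open>
  A step \<open>(e, True)\<close> traverses the arc \<open>e\<close> from tail to head, and \<open>(e, False)\<close> traverses it
  from head to tail. Walks in the resulting digraph are the walks of the underlying undirected
  multigraph of \<open>G\<close>, together with a direction of traversal.
\<close>

definition bidirected :: "('a, 'b) pre_digraph \<Rightarrow> ('a, 'b \<times> bool) pre_digraph" where
  "bidirected G =
     \<lparr>verts = verts G,
      arcs = arcs G \<times> UNIV,
      tail = (\<lambda>(e, d). if d then tail G e else head G e),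
      head = (\<lambda>(e, d). if d then head G e else tail G e)\<rparr>"

text \<open>
  The condition on first components excludes traversing a single arc forth and back. A loop is a
  circuit of length 1, and two parallel or antiparallel arcs form a circuit of length 2. A circuit
  is represented by a closed traversal; changing the starting vertex leaves the two sets below
  unchanged, and reversing the direction of traversal swaps them.
\<close>

definition circuit :: "('a, 'b) pre_digraph \<Rightarrow> ('b \<times> bool) list \<Rightarrow> bool" where
  "circuit G C \<longleftrightarrow> pre_digraph.cycle (bidirected G) C \<and> distinct (map fst C)"

definition circuit_pos :: "('b \<times> bool) list \<Rightarrow> 'b set" where
  "circuit_pos C = {e. (e, True) \<in> set C}"

definition circuit_neg :: "('b \<times> bool) list \<Rightarrow> 'b set" where
  "circuit_neg C = {e. (e, False) \<in> set C}"


section \<open>Tensions and tension-continuous mappings\<close>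

text \<open>Groups are written multiplicatively in HOL-Algebra, so the sums become \<open>finprod\<close>.\<close>

definition tension :: "('m, 'x) monoid_scheme \<Rightarrow> ('a, 'b) pre_digraph \<Rightarrow> ('b \<Rightarrow> 'm) \<Rightarrow> bool" where
  "tension M G \<tau> \<longleftrightarrow>
     \<tau> \<in> arcs G \<rightarrow> carrier M \<and>
     (\<forall>C. circuit G C \<longrightarrow> finprod M \<tau> (circuit_pos C) = finprod M \<tau> (circuit_neg C))"

definition tension_continuous ::
  "('m, 'x) monoid_scheme \<Rightarrow> ('a, 'b) pre_digraph \<Rightarrow> ('c, 'd) pre_digraph \<Rightarrow> ('b \<Rightarrow> 'd) \<Rightarrow> bool" where
  "tension_continuous M G H f \<longleftrightarrow>
     f \<in> arcs G \<rightarrow> arcs H \<and> (\<forall>\<tau>. tension M H \<tau> \<longrightarrow> tension M G (\<tau> \<circ> f))"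

text \<open>Extensionality (\<open>\<rightarrow>\<^sub>E\<close>) makes the functions below correspond to mappings on the arc set only.\<close>

definition tension_continuous_maps ::
  "('m, 'x) monoid_scheme \<Rightarrow> ('a, 'b) pre_digraph \<Rightarrow> ('c, 'd) pre_digraph \<Rightarrow> ('b \<Rightarrow> 'd) set" where
  "tension_continuous_maps M G H = {f \<in> arcs G \<rightarrow>\<^sub>E arcs H. tension_continuous M G H f}"


section \<open>Finitely generated abelian groups\<close>

definition fg_comm_group :: "('m, 'x) monoid_scheme \<Rightarrow> bool" where
  "fg_comm_group M \<longleftrightarrow>
     comm_group M \<and> (\<exists>S. finite S \<and> S \<subseteq> carrier M \<and> generate M S = carrier M)"

text \<open>The group $\mathbb{Z}^\alpha \times \prod_{i=1}^k \mathbb{Z}_{n_i}^{\beta_i}$.\<close>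

definition cyclic_product ::
  "nat \<Rightarrow> nat \<Rightarrow> (nat \<Rightarrow> nat) \<Rightarrow> (nat \<Rightarrow> nat) \<Rightarrow> ((nat \<Rightarrow> int) \<times> (nat \<Rightarrow> nat \<Rightarrow> int)) monoid" where
  "cyclic_product \<alpha> k n \<beta> =
     product_group {1..\<alpha>} (\<lambda>_. integer_group) \<times>\<times>
     product_group {1..k} (\<lambda>i. product_group {1..\<beta> i} (\<lambda>_. integer_mod_group (n i)))"

definition group_n_value :: "('m, 'x) monoid_scheme \<Rightarrow> enat \<Rightarrow> bool" where
  "group_n_value M v \<longleftrightarrow>
     (\<exists>\<alpha> k n \<beta>. (\<forall>i\<in>{1..k}. n i \<ge> 1 \<and> \<beta> i \<ge> 1) \<and>
        M \<cong> cyclic_product \<alpha> k n \<beta> \<and>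
        v = (if \<alpha> > 0 then \<infinity> else enat (Lcm (n ` {1..k}))))"

definition group_n :: "('m, 'x) monoid_scheme \<Rightarrow> enat" where
  "group_n M = (THE v. group_n_value M v)"


subsection \<open>Independence of the chosen decomposition\<close>

definition annihilates :: "nat \<Rightarrow> ('m, 'x) monoid_scheme \<Rightarrow> bool" where
  "annihilates m G \<longleftrightarrow> (\<forall>x\<in>carrier G. x [^]\<^bsub>G\<^esub> m = \<one>\<^bsub>G\<^esub>)"

lemma annihilates_integer_group: "annihilates m integer_group \<longleftrightarrow> m = 0"
  by (auto simp: annihilates_def dest: spec[of _ 1])

lemma annihilates_integer_mod_group:
  assumes "n \<ge> 1" shows "annihilates m (integer_mod_group n) \<longleftrightarrow> n dvd m"
proof
  assume "n dvd m"
  then show "annihilates m (integer_mod_group n)"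
    by (auto simp: annihilates_def)
next
  assume A: "annihilates m (integer_mod_group n)"
  show "n dvd m"
  proof (cases "n = 1")
    case False
    with assms have "1 \<in> carrier (integer_mod_group n)"
      by (simp add: carrier_integer_mod_group)
    with A have "1 [^]\<^bsub>integer_mod_group n\<^esub> m = \<one>\<^bsub>integer_mod_group n\<^esub>"
      unfolding annihilates_def by blast
    then have "int m mod int n = 0"
      by simp
    then show ?thesis
      by presburger
  qed simp
qed

lemma pow_product_group:
  "x [^]\<^bsub>product_group I G\<^esub> (m :: nat) = (\<lambda>i\<in>I. x i [^]\<^bsub>G i\<^esub> m)"
  by (induction m) (auto simp: fun_eq_iff)

lemma annihilates_product_group:
  assumes "\<And>i. i \<in> I \<Longrightarrow> group (G i)"
  shows "annihilates m (product_group I G) \<longleftrightarrow> (\<forall>i\<in>I. annihilates m (G i))"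
proof
  assume A: "annihilates m (product_group I G)"
  show "\<forall>i\<in>I. annihilates m (G i)"
    unfolding annihilates_def
  proof (intro ballI)
    fix i x assume i: "i \<in> I" and x: "x \<in> carrier (G i)"
    define y where "y = (\<lambda>j\<in>I. if j = i then x else \<one>\<^bsub>G j\<^esub>)"
    have "y \<in> carrier (product_group I G)"
      using x assms by (auto simp: y_def intro!: monoid.one_closed[OF group.is_monoid])
    with A have "(\<lambda>j\<in>I. y j [^]\<^bsub>G j\<^esub> m) i = (\<lambda>j\<in>I. \<one>\<^bsub>G j\<^esub>) i"
      by (simp add: annihilates_def pow_product_group)
    with i show "x [^]\<^bsub>G i\<^esub> m = \<one>\<^bsub>G i\<^esub>"
      by (simp add: y_def)
  qed
next
  assume "\<forall>i\<in>I. annihilates m (G i)"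
  then show "annihilates m (product_group I G)"
    by (auto simp: annihilates_def pow_product_group PiE_iff intro!: restrict_ext)
qed

lemma pow_DirProd: "x [^]\<^bsub>G \<times>\<times> H\<^esub> (m :: nat) = (fst x [^]\<^bsub>G\<^esub> m, snd x [^]\<^bsub>H\<^esub> m)"
  by (induction m) (auto simp: mult_DirProd')

lemma annihilates_DirProd:
  assumes "group G" "group H"
  shows "annihilates m (G \<times>\<times> H) \<longleftrightarrow> annihilates m G \<and> annihilates m H"
proof -
  have "\<one>\<^bsub>G\<^esub> \<in> carrier G" "\<one>\<^bsub>H\<^esub> \<in> carrier H"
    using assms by (auto intro: group.is_monoid monoid.one_closed)
  then show ?thesis
    by (auto simp: annihilates_def pow_DirProd)
qed

lemma group_cyclic_product: "group (cyclic_product \<alpha> k n \<beta>)"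
  unfolding cyclic_product_def by (intro DirProd_group) auto

lemma annihilates_cyclic_product:
  assumes "\<forall>i\<in>{1..k}. n i \<ge> 1 \<and> \<beta> i \<ge> 1" and "m > 0"
  shows "annihilates m (cyclic_product \<alpha> k n \<beta>) \<longleftrightarrow> \<alpha> = 0 \<and> Lcm (n ` {1..k}) dvd m"
proof -
  have "annihilates m (product_group {1..\<beta> i} (\<lambda>_. integer_mod_group (n i))) \<longleftrightarrow> n i dvd m"
    if "i \<in> {1..k}" for i
    using assms(1) that by (auto simp: annihilates_product_group annihilates_integer_mod_group)
  then have "annihilates m
       (product_group {1..k} (\<lambda>i. product_group {1..\<beta> i} (\<lambda>_. integer_mod_group (n i))))
     \<longleftrightarrow> (\<forall>i\<in>{1..k}. n i dvd m)"
    by (simp add: annihilates_product_group)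
  moreover have "annihilates m (product_group {1..\<alpha>} (\<lambda>_. integer_group)) \<longleftrightarrow> \<alpha> = 0"
    using assms(2) by (auto simp: annihilates_product_group annihilates_integer_group)
  ultimately show ?thesis
    by (auto simp: cyclic_product_def annihilates_DirProd Lcm_dvd_iff)
qed

lemma annihilates_hom_onto:
  assumes "group G" "group H" "h \<in> hom G H" "h ` carrier G = carrier H" "annihilates m G"
  shows "annihilates m H"
  unfolding annihilates_def
proof
  fix y assume "y \<in> carrier H"
  then obtain x where x: "x \<in> carrier G" "y = h x"
    using assms(4) by blast
  interpret group_hom G H h
    using assms by (simp add: group_hom_def group_hom_axioms_def)
  have "y [^]\<^bsub>H\<^esub> m = h (x [^]\<^bsub>G\<^esub> m)"
    using x by (simp add: hom_nat_pow)
  then show "y [^]\<^bsub>H\<^esub> m = \<one>\<^bsub>H\<^esub>"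
    using x assms(5) by (simp add: annihilates_def)
qed

lemma annihilates_iso:
  assumes "group G" "group H" "G \<cong> H"
  shows "annihilates m G \<longleftrightarrow> annihilates m H"
proof -
  obtain h where h: "h \<in> iso G H"
    using assms(3) by (auto simp: is_iso_def)
  obtain h' where h': "h' \<in> iso H G"
    using group.iso_sym[OF assms(1,3)] by (auto simp: is_iso_def)
  have "annihilates m H" if "annihilates m G"
    using annihilates_hom_onto[OF assms(1,2) _ _ that] h by (auto simp: iso_def bij_betw_def)
  moreover have "annihilates m G" if "annihilates m H"
    using annihilates_hom_onto[OF assms(2,1) _ _ that] h' by (auto simp: iso_def bij_betw_def)
  ultimately show ?thesis
    by blast
qed

lemma group_n_value_unique:
  assumes "group M" "group_n_value M v" "group_n_value M w"
  shows "v = w"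
proof -
  have key: "annihilates m M \<longleftrightarrow> (\<exists>d. u = enat d \<and> d dvd m)"
    if u: "group_n_value M u" and m: "m > 0" for u m
  proof -
    obtain \<alpha> k n \<beta> where *: "\<forall>i\<in>{1..k}. n i \<ge> 1 \<and> \<beta> i \<ge> 1" "M \<cong> cyclic_product \<alpha> k n \<beta>"
      "u = (if \<alpha> > 0 then \<infinity> else enat (Lcm (n ` {1..k})))"
      using u unfolding group_n_value_def by blast
    have "annihilates m M \<longleftrightarrow> annihilates m (cyclic_product \<alpha> k n \<beta>)"
      by (rule annihilates_iso[OF assms(1) group_cyclic_product *(2)])
    then show ?thesis
      using annihilates_cyclic_product[OF *(1) m] *(3) by auto
  qed
  have pos: "d > 0" if "group_n_value M (enat d)" for d
    using that
    by (force simp: group_n_value_def Lcm_0_iff_nat intro!: Nat.gr0I split: if_splits)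
  show ?thesis
  proof (cases v; cases w)
    fix a b assume ab: "v = enat a" "w = enat b"
    have "a > 0" "b > 0"
      using pos assms ab by auto
    then have "b dvd a" "a dvd b"
      using key[OF assms(2), of a] key[OF assms(3), of a]
        key[OF assms(2), of b] key[OF assms(3), of b] ab by auto
    then show ?thesis
      using ab by (simp add: dvd_antisym)
  next
    fix a assume ab: "v = enat a" "w = \<infinity>"
    have "a > 0"
      using pos assms ab by auto
    then show ?thesis
      using key[OF assms(2), of a] key[OF assms(3), of a] ab by auto
  next
    fix b assume ab: "v = \<infinity>" "w = enat b"
    have "b > 0"
      using pos assms ab by auto
    then show ?thesis
      using key[OF assms(2), of b] key[OF assms(3), of b] ab by auto
  qed simp
qed

lemma group_n_eq:
  assumes "group M" "M \<cong> cyclic_product \<alpha> k n \<beta>" "\<forall>i\<in>{1..k}. n i \<ge> 1 \<and> \<beta> i \<ge> 1"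
  shows "group_n M = (if \<alpha> > 0 then \<infinity> else enat (Lcm (n ` {1..k})))"
  unfolding group_n_def
proof (rule the_equality)
  show *: "group_n_value M (if \<alpha> > 0 then \<infinity> else enat (Lcm (n ` {1..k})))"
    using assms(2,3) unfolding group_n_value_def by blast
  show "v = (if \<alpha> > 0 then \<infinity> else enat (Lcm (n ` {1..k})))" if "group_n_value M v" for v
    using group_n_value_unique[OF assms(1) that *] .
qed

end

theory Submission
  imports Defs "HOL-Algebra.Multiplicative_Group"
begin

text \<open>
  On a finite digraph \<open>H\<close> the tensions are exactly the potential differences. Testing
  tension-continuity of \<open>f\<close> on the differences of potentials that take the value \<open>x\<close> at one vertex
  and are trivial elsewhere shows that \<open>f\<close> is \<open>M\<close>-tension-continuous iff, for every circuit of the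
  source, the boundary of its image chain has all coefficients in the annihilator of \<open>M\<close>. Only the
  annihilator of \<open>M\<close> enters here, and by the structure theorem for finitely generated abelian groups
  it is determined by \<open>group_n M\<close>. So the two sets of mappings are even equal.
\<close>

section \<open>Finitely generated abelian groups\<close>

context comm_group
begin

text \<open>An indexed family instead of a set of elements: changing a member may make it trivial or
  equal to another one, while the index set stays fixed.\<close>

definition lincomb :: "('i \<Rightarrow> 'a) \<Rightarrow> 'i set \<Rightarrow> ('i \<Rightarrow> int) \<Rightarrow> 'a" where
  "lincomb x I a = (\<Otimes>i\<in>I. x i [^] a i)"

definition lspan :: "('i \<Rightarrow> 'a) \<Rightarrow> 'i set \<Rightarrow> 'a set" where
  "lspan x I = range (lincomb x I)"

text \<open>The terms have to vanish, not the coefficients, because members may have torsion. For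
  finite \<open>I\<close> this says that the span is the internal direct product of the cyclic
  subgroups generated by the members; trivial members are allowed.\<close>

definition indep :: "('i \<Rightarrow> 'a) \<Rightarrow> 'i set \<Rightarrow> bool" where
  "indep x I \<longleftrightarrow> (\<forall>a. lincomb x I a = \<one> \<longrightarrow> (\<forall>i\<in>I. x i [^] a i = \<one>))"

lemma lincomb_in_lspan [simp]: "lincomb x I a \<in> lspan x I"
  by (simp add: lspan_def)

lemma lspanE:
  assumes "h \<in> lspan x I"
  obtains a where "h = lincomb x I a"
  using assms by (auto simp: lspan_def)

lemma lincomb_closed [simp]: "x \<in> I \<rightarrow> carrier G \<Longrightarrow> lincomb x I a \<in> carrier G"
  unfolding lincomb_def by (intro finprod_closed) auto

text \<open>Comparing terms instead of coefficients allows a coefficient to be reduced modulo the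
  order of its member.\<close>

lemma lincomb_cong_pow:
  assumes "x \<in> I \<rightarrow> carrier G" "\<And>i. i \<in> I \<Longrightarrow> x i [^] a i = y i [^] b i"
  shows "lincomb x I a = lincomb y I b"
proof -
  have "lincomb y I b = lincomb x I a"
    unfolding lincomb_def using assms by (intro finprod_cong') auto
  then show ?thesis ..
qed

lemma lincomb_cong:
  assumes "x \<in> I \<rightarrow> carrier G" "\<And>i. i \<in> I \<Longrightarrow> x i = y i" "\<And>i. i \<in> I \<Longrightarrow> a i = b i"
  shows "lincomb x I a = lincomb y I b"
  using assms by (intro lincomb_cong_pow) auto

lemma lincomb_add:
  assumes "x \<in> I \<rightarrow> carrier G"
  shows "lincomb x I (\<lambda>i. a i + b i) = lincomb x I a \<otimes> lincomb x I b"
proof -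
  have "lincomb x I (\<lambda>i. a i + b i) = (\<Otimes>i\<in>I. x i [^] a i \<otimes> x i [^] b i)"
    unfolding lincomb_def using assms by (intro finprod_cong') (auto simp: int_pow_mult Pi_iff)
  then show ?thesis
    unfolding lincomb_def using assms by (subst (asm) finprod_multf) (auto simp: Pi_iff)
qed

lemma lincomb_scale:
  assumes "x \<in> I \<rightarrow> carrier G"
  shows "lincomb x I (\<lambda>i. a i * c) = lincomb x I a [^] (c :: int)"
  using assms unfolding lincomb_def
  by (induction I rule: infinite_finite_induct)
    (simp_all add: Pi_iff int_pow_pow int_pow_distrib finprod_closed)

lemma lincomb_diff:
  assumes "x \<in> I \<rightarrow> carrier G"
  shows "lincomb x I (\<lambda>i. a i - b i) = lincomb x I a \<otimes> inv (lincomb x I b)"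
  using lincomb_add[OF assms, of a "\<lambda>i. b i * (-1)"] lincomb_scale[OF assms, of b "-1"] assms
  by (simp add: int_pow_neg)

lemma lincomb_remove:
  assumes "finite I" "x \<in> I \<rightarrow> carrier G" "j \<in> I"
  shows "lincomb x I a = x j [^] a j \<otimes> lincomb x (I - {j}) a"
  using finprod_insert[of "I - {j}" j "\<lambda>i. x i [^] a i"] assms
  by (auto simp: lincomb_def insert_absorb Pi_iff)

lemma lincomb_zero: "(\<And>i. i \<in> I \<Longrightarrow> a i = 0) \<Longrightarrow> lincomb x I a = \<one>"
  unfolding lincomb_def by (intro finprod_one_eqI) simp

lemma lincomb_indicator:
  assumes "finite I" "x \<in> I \<rightarrow> carrier G" "j \<in> I"
  shows "lincomb x I (\<lambda>i. if i = j then c else 0) = x j [^] c"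
proof -
  have "lincomb x (I - {j}) (\<lambda>i. if i = j then c else 0) = \<one>"
    by (intro lincomb_zero) auto
  then show ?thesis
    using assms lincomb_remove[OF assms] by (auto simp: Pi_iff)
qed

text \<open>Expanding the power of the new member spreads the exponent \<open>a j\<close> over the
  other members. A shear of the family thus acts on coefficients as an elementary integer operation
  that leaves the coefficient at \<open>j\<close> alone.\<close>

lemma lincomb_shear:
  assumes "finite I" "x \<in> I \<rightarrow> carrier G" "j \<in> I"
  shows "lincomb (x(j := x j \<otimes> lincomb x (I - {j}) q)) I a =
    lincomb x I (\<lambda>i. if i = j then a j else a i + q i * a j)"
proof -
  let ?J = "I - {j}"
  let ?y = "x(j := x j \<otimes> lincomb x ?J q)"
  have xJ: "x \<in> ?J \<rightarrow> carrier G" and xj: "x j \<in> carrier G"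
    using assms by auto
  have y: "?y \<in> I \<rightarrow> carrier G"
    using assms(2) lincomb_closed[OF xJ, of q] xj by (auto simp: Pi_iff simp del: lincomb_closed)
  have "lincomb ?y I a = (x j \<otimes> lincomb x ?J q) [^] a j \<otimes> lincomb ?y ?J a"
    by (subst lincomb_remove[OF assms(1) y assms(3)]) simp
  also have "lincomb ?y ?J a = lincomb x ?J a"
    using xJ by (intro lincomb_cong[symmetric]) auto
  also have "(x j \<otimes> lincomb x ?J q) [^] a j = x j [^] a j \<otimes> lincomb x ?J (\<lambda>i. q i * a j)"
    using xj xJ by (simp add: int_pow_distrib lincomb_scale)
  also have "\<dots> \<otimes> lincomb x ?J a = x j [^] a j \<otimes> lincomb x ?J (\<lambda>i. a i + q i * a j)"
    using xj xJ by (simp add: lincomb_add m_ac)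
  also have "lincomb x ?J (\<lambda>i. a i + q i * a j) =
      lincomb x ?J (\<lambda>i. if i = j then a j else a i + q i * a j)"
    using xJ by (intro lincomb_cong) auto
  also have "x j [^] a j \<otimes> \<dots> = lincomb x I (\<lambda>i. if i = j then a j else a i + q i * a j)"
    by (subst lincomb_remove[OF assms]) simp
  finally show ?thesis .
qed

lemma shear_closed:
  assumes "x \<in> I \<rightarrow> carrier G" "j \<in> I"
  shows "x(j := x j \<otimes> lincomb x (I - {j}) q) \<in> I \<rightarrow> carrier G"
proof -
  have "x \<in> I - {j} \<rightarrow> carrier G"
    using assms(1) by auto
  then show ?thesis
    using assms by (auto simp: Pi_iff intro!: m_closed lincomb_closed)
qed

text \<open>The operation on coefficients is undone by subtracting \<open>q i * a j\<close>, so
  every combination of the old family is one of the sheared family.\<close>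

lemma lspan_shear:
  assumes "finite I" "x \<in> I \<rightarrow> carrier G" "j \<in> I"
  shows "lspan (x(j := x j \<otimes> lincomb x (I - {j}) q)) I = lspan x I"
proof -
  have "lincomb x I a \<in> lspan (x(j := x j \<otimes> lincomb x (I - {j}) q)) I" for a
  proof -
    let ?b = "\<lambda>i. if i = j then a j else a i - q i * a j"
    have "lincomb (x(j := x j \<otimes> lincomb x (I - {j}) q)) I ?b = lincomb x I a"
      unfolding lincomb_shear[OF assms] by (intro lincomb_cong assms) auto
    then show ?thesis
      using lincomb_in_lspan[of "x(j := x j \<otimes> lincomb x (I - {j}) q)" I ?b] by simp
  qed
  moreover have "lincomb (x(j := x j \<otimes> lincomb x (I - {j}) q)) I a \<in> lspan x I" for a
    unfolding lincomb_shear[OF assms] by simp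
  ultimately show ?thesis
    by (auto elim!: lspanE)
qed

section \<open>Independent families with a given span\<close>

text \<open>
  Take the least positive coefficient \<open>d\<close> occurring in a relation of any family with the same span.
  Minimality makes \<open>d\<close> divide the other coefficients of that relation, so a shear turns the relation
  into \<open>d\<close> times a single member, and this member splits off.
\<close>

lemma ex_indep_same_span:
  assumes "finite I" "x \<in> I \<rightarrow> carrier G"
  shows "\<exists>z \<in> I \<rightarrow> carrier G. lspan z I = lspan x I \<and> indep z I"
  using assms
proof (induction I arbitrary: x rule: finite_psubset_induct)
  case (psubset I)
  define P where "P m \<longleftrightarrow> m > 0 \<and> (\<exists>y a j. y \<in> I \<rightarrow> carrier G \<and> lspan y I = lspan x I \<and>
    j \<in> I \<and> lincomb y I a = \<one> \<and> a j = int m)" for m :: nat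
  show ?case
  proof (cases "\<exists>m. P m")
    case False
    have "a j = 0" if a: "lincomb x I a = \<one>" and j: "j \<in> I" for a j
    proof (rule ccontr)
      assume nz: "a j \<noteq> 0"
      \<comment> \<open>Scaling the relation by the sign of \<open>a j\<close> turns the coefficient
        at \<open>j\<close> into its absolute value, which is positive.\<close>
      let ?b = "\<lambda>i. a i * sgn (a j)"
      have "lincomb x I ?b = \<one>"
        using a psubset.prems by (simp add: lincomb_scale)
      moreover have "?b j = int (nat \<bar>a j\<bar>)"
        by (simp add: mult_sgn_abs mult.commute flip: abs_sgn)
      ultimately have "P (nat \<bar>a j\<bar>)"
        unfolding P_def using nz j psubset.prems by auto
      with False show False
        by blast
    qed
    then have "indep x I"
      unfolding indep_def by (metis int_pow_0)
    then show ?thesis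
      using psubset.prems by blast
  next
    case True
    define d where "d = (LEAST m. P m)"
    have Pd: "P d"
      unfolding d_def using True by (metis LeastI)
    have min: "d \<le> m" if "P m" for m
      unfolding d_def using that by (rule Least_le)
    have d0: "int d > 0"
      using Pd by (simp add: P_def)
    \<comment> \<open>A nonzero remainder modulo \<open>d\<close> occurring as a coefficient of a
      relation would be a positive coefficient below the minimum \<open>d\<close>.\<close>
    have mod0: "c mod int d = 0"
      if "y \<in> I \<rightarrow> carrier G" "lspan y I = lspan x I" "i \<in> I" "lincomb y I b = \<one>"
        "b i = c mod int d" for y b i c
    proof (rule ccontr)
      assume "c mod int d \<noteq> 0"
      moreover have "0 \<le> c mod int d" "c mod int d < int d"
        using d0 by auto
      ultimately have "nat (c mod int d) > 0" "nat (c mod int d) < d" "b i = int (nat (c mod int d))"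
        using that(5) by linarith+
      then have "P (nat (c mod int d))"
        unfolding P_def using that by blast
      with min[of "nat (c mod int d)"] \<open>nat (c mod int d) < d\<close> show False
        by simp
    qed
    obtain y a j where y: "y \<in> I \<rightarrow> carrier G" "lspan y I = lspan x I" and j: "j \<in> I"
      and a: "lincomb y I a = \<one>" "a j = int d"
      using Pd unfolding P_def by blast
    \<comment> \<open>Shearing \<open>y j\<close> by \<open>y i\<close> replaces the coefficient \<open>a i\<close> by its remainder modulo \<open>d\<close>.\<close>
    have dvd_a: "a i mod int d = 0" if i: "i \<in> I" "i \<noteq> j" for i
    proof -
      let ?q = "\<lambda>k. if k = i then a i div int d else 0"
      let ?y = "y(j := y j \<otimes> lincomb y (I - {j}) ?q)"
      let ?b = "\<lambda>k. if k = i then a i mod int d else a k"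
      have "lincomb ?y I ?b = lincomb y I a"
        unfolding lincomb_shear[OF psubset.hyps(1) y(1) j]
        using i a(2) by (intro lincomb_cong y) (auto simp: mod_div_mult_eq)
      then show ?thesis
        using mod0[OF shear_closed[OF y(1) j], of ?q i ?b "a i"] i a(1)
          lspan_shear[OF psubset.hyps(1) y(1) j] y(2) by auto
    qed
    define q where "q i = a i div int d" for i
    define y' where "y' = y(j := y j \<otimes> lincomb y (I - {j}) q)"
    have y': "y' \<in> I \<rightarrow> carrier G" "lspan y' I = lspan x I"
      unfolding y'_def using shear_closed[OF y(1) j] lspan_shear[OF psubset.hyps(1) y(1) j] y(2) by auto
    have y'I: "y' \<in> I - {j} \<rightarrow> carrier G" and y'j: "y' j \<in> carrier G"
      using y'(1) j by auto
    let ?e = "\<lambda>i. if i = j then int d else 0"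
    \<comment> \<open>In terms of \<open>y\<close>, the vector \<open>?e\<close> has the coefficient
      \<open>d\<close> at \<open>j\<close> and \<open>q i * d = a i\<close> elsewhere. The whole
      relation collapses to a single power of \<open>y' j\<close>.\<close>
    have "lincomb y' I ?e = lincomb y I a"
      unfolding y'_def lincomb_shear[OF psubset.hyps(1) y(1) j]
      using a(2) dvd_a by (intro lincomb_cong y) (auto simp: q_def dvd_div_mult_self mod_eq_0_iff_dvd)
    then have y'd: "y' j [^] int d = \<one>" and rel: "lincomb y' I ?e = \<one>"
      using a(1) lincomb_indicator[OF psubset.hyps(1) y'(1) j] by auto
    \<comment> \<open>Subtracting a multiple of the relation \<open>?e\<close> leaves the
      coefficient \<open>b j mod d\<close> at \<open>j\<close>, which is 0 by minimality. Hence the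
      term at \<open>j\<close> is trivial in every relation of \<open>y'\<close>, and this is what
      lets \<open>y' j\<close> split off.\<close>
    have coeff: "y' j [^] b j = \<one>" if b: "lincomb y' I b = \<one>" for b
    proof -
      let ?c = "\<lambda>i. b i - ?e i * (b j div int d)"
      have "lincomb y' I ?c = \<one>"
        using lincomb_diff[OF y'(1), of b "\<lambda>i. ?e i * (b j div int d)"]
          lincomb_scale[OF y'(1), of ?e "b j div int d"] b rel by simp
      moreover have "?c j = b j mod int d"
        by (simp add: minus_mult_div_eq_mod)
      ultimately have "b j mod int d = 0"
        using mod0[OF y' j] by blast
      then have "b j = int d * (b j div int d)"
        by (metis add.right_neutral mult_div_mod_eq)
      then have "y' j [^] b j = (y' j [^] int d) [^] (b j div int d)"
        using int_pow_pow[OF y'j, of "int d" "b j div int d"] by simp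
      then show ?thesis
        by (simp add: y'd)
    qed
    obtain z where z: "z \<in> I - {j} \<rightarrow> carrier G" "lspan z (I - {j}) = lspan y' (I - {j})"
      and ind: "indep z (I - {j})"
      using psubset.IH[of "I - {j}" y'] j y'I by blast
    define w where "w = z(j := y' j)"
    have w: "w \<in> I \<rightarrow> carrier G"
      using z(1) y'j by (auto simp: w_def)
    have wlin: "lincomb w I b = y' j [^] b j \<otimes> lincomb z (I - {j}) b" for b
    proof -
      have "lincomb w (I - {j}) b = lincomb z (I - {j}) b"
        using z(1) by (intro lincomb_cong[symmetric]) (auto simp: w_def)
      then show ?thesis
        using lincomb_remove[OF psubset.hyps(1) w j] by (simp add: w_def)
    qed
    have y'lin: "lincomb y' I b = y' j [^] b j \<otimes> lincomb y' (I - {j}) b" for b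
      by (rule lincomb_remove[OF psubset.hyps(1) y'(1) j])
    \<comment> \<open>Only coefficients on \<open>I - {j}\<close> enter here, so the value at
      \<open>j\<close> is free and can be set to \<open>b j\<close>. One function \<open>c\<close>
      then describes a combination over all of \<open>I\<close>.\<close>
    have transfer: "\<exists>c. c j = b j \<and> lincomb v (I - {j}) c = lincomb u (I - {j}) b"
      if uv: "lspan u (I - {j}) = lspan v (I - {j})" and v: "v \<in> I - {j} \<rightarrow> carrier G" for u v b
    proof -
      obtain c where "lincomb u (I - {j}) b = lincomb v (I - {j}) c"
        using lincomb_in_lspan[of u "I - {j}" b] unfolding uv by (rule lspanE)
      moreover have "lincomb v (I - {j}) c = lincomb v (I - {j}) (c(j := b j))"
        using v by (intro lincomb_cong) auto
      ultimately show ?thesis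
        by (metis fun_upd_same)
    qed
    have "lspan w I = lspan y' I"
    proof -
      have "lincomb w I b \<in> lspan y' I" for b
        using transfer[OF z(2) y'I, of b] unfolding wlin
        by (metis lincomb_in_lspan y'lin)
      moreover have "lincomb y' I b \<in> lspan w I" for b
        using transfer[OF z(2)[symmetric] z(1), of b] unfolding y'lin
        by (metis lincomb_in_lspan wlin)
      ultimately show ?thesis
        by (auto elim!: lspanE)
    qed
    moreover have "indep w I"
      unfolding indep_def
    proof (intro allI impI)
      fix b assume b: "lincomb w I b = \<one>"
      \<comment> \<open>The relation of \<open>w\<close> becomes one of \<open>y'\<close>, where
        \<open>coeff\<close> removes the term at \<open>j\<close>; what remains is a relation of the
        independent family \<open>z\<close>.\<close>
      obtain c where c: "c j = b j" "lincomb y' (I - {j}) c = lincomb z (I - {j}) b"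
        using transfer[OF z(2) y'I] by blast
      have "lincomb y' I c = \<one>"
        using b unfolding wlin y'lin by (simp add: c)
      then have j1: "y' j [^] b j = \<one>"
        using coeff[of c] by (simp add: c)
      then have "lincomb z (I - {j}) b = \<one>"
        using b z(1) unfolding wlin by simp
      then have "\<forall>i\<in>I - {j}. z i [^] b i = \<one>"
        using ind unfolding indep_def by blast
      then show "\<forall>i\<in>I. w i [^] b i = \<one>"
        using j1 by (auto simp: w_def)
    qed
    ultimately show ?thesis
      using w y'(2) by auto
  qed
qed

section \<open>From generators to a product of cyclic groups\<close>

lemma generate_subset_lspan:
  assumes "finite S" "S \<subseteq> carrier G"
  shows "generate G S \<subseteq> lspan (\<lambda>s. s) S"
proof
  have S: "(\<lambda>s. s) \<in> S \<rightarrow> carrier G"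
    using assms(2) by auto
  fix h assume "h \<in> generate G S"
  then show "h \<in> lspan (\<lambda>s. s) S"
  proof (induction rule: generate.induct)
    case one
    show ?case
      using lincomb_in_lspan[of "\<lambda>s. s" S "\<lambda>_. 0"] by (simp add: lincomb_zero)
  next
    case (incl h)
    then show ?case
      using lincomb_indicator[OF assms(1) S incl, of 1] assms(2)
        lincomb_in_lspan[of "\<lambda>s. s" S "\<lambda>i. if i = h then 1 else 0"] by auto
  next
    case (inv h)
    then show ?case
      using lincomb_indicator[OF assms(1) S inv, of "-1"] assms(2)
        lincomb_in_lspan[of "\<lambda>s. s" S "\<lambda>i. if i = h then -1 else 0"] by (auto simp: int_pow_neg)
  next
    case (eng h1 h2)
    then obtain a b where "h1 = lincomb (\<lambda>s. s) S a" "h2 = lincomb (\<lambda>s. s) S b"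
      by (auto elim!: lspanE)
    then show ?case
      using lincomb_in_lspan[of "\<lambda>s. s" S "\<lambda>i. a i + b i"] by (simp add: lincomb_add[OF S])
  qed
qed

text \<open>Infinite order is covered as well: then \<open>ord x = 0\<close>, and reduction modulo 0
  changes nothing.\<close>

lemma int_pow_mod_ord:
  assumes "x \<in> carrier G"
  shows "x [^] (k mod int (ord x)) = x [^] k"
  using assms by (simp add: int_pow_eq flip: mod_eq_dvd_iff)

text \<open>Members of infinite order supply the factors \<int>, the others cyclic factors of their
  orders, and \<open>\<Phi>\<close> sends a tuple to the combination with these coefficients.
  Independence makes \<open>\<Phi>\<close> injective, spanning makes it surjective.\<close>

lemma ex_iso_cyclic_product:
  assumes "finite S" and z: "z \<in> S \<rightarrow> carrier G" and span: "lspan z S = carrier G" and ind: "indep z S"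
  shows "\<exists>\<alpha> k n \<beta>. (\<forall>i\<in>{1..k}. n i \<ge> 1 \<and> \<beta> i \<ge> 1) \<and> G \<cong> cyclic_product \<alpha> k n \<beta>"
proof -
  define S0 where "S0 = {s\<in>S. ord (z s) = 0}"
  have "finite S0" "finite (S - S0)"
    using assms(1) by (auto simp: S0_def)
  then obtain g h where g: "bij_betw g {1..card S0} S0" and h: "bij_betw h {1..card (S - S0)} (S - S0)"
    using ex_bij_betw_nat_finite_1 by metis
  define \<alpha> k where "\<alpha> = card S0" and "k = card (S - S0)"
  define n where "n i = ord (z (h i))" for i
  define g' h' where "g' = inv_into {1..\<alpha>} g" and "h' = inv_into {1..k} h"
  have g1: "g (g' s) = s" "g' s \<in> {1..\<alpha>}" if "s \<in> S0" for s
    using bij_betw_inv_into_right[OF g that] bij_betwE[OF bij_betw_inv_into[OF g]] that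
    by (auto simp: g'_def \<alpha>_def)
  have h1: "h (h' s) = s" "h' s \<in> {1..k}" if "s \<in> S" "s \<notin> S0" for s
    using bij_betw_inv_into_right[OF h, of s] bij_betwE[OF bij_betw_inv_into[OF h]] that
    by (auto simp: h'_def k_def)
  have g2: "g i \<in> S0" "g i \<in> S" "g' (g i) = i" if "i \<in> {1..\<alpha>}" for i
    using bij_betwE[OF g] bij_betw_inv_into_left[OF g] that by (auto simp: g'_def \<alpha>_def S0_def)
  have h2: "h i \<in> S" "h i \<notin> S0" "h' (h i) = i" if "i \<in> {1..k}" for i
    using bij_betwE[OF h] bij_betw_inv_into_left[OF h] that by (auto simp: h'_def k_def)
  have n1: "n i \<ge> 1" if "i \<in> {1..k}" for i
    using h2[OF that] by (auto simp: n_def S0_def)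
  \<comment> \<open>All multiplicities are 1: every member of finite order has its own index, so
    equal orders are repeated among the \<open>n i\<close>.\<close>
  let ?C = "cyclic_product \<alpha> k n (\<lambda>_. 1)"
  have carr: "p \<in> carrier ?C \<longleftrightarrow> fst p \<in> {1..\<alpha>} \<rightarrow>\<^sub>E UNIV \<and>
      snd p \<in> (\<Pi>\<^sub>E i\<in>{1..k}. \<Pi>\<^sub>E j\<in>{1..1}. {0..<int (n i)})" for p
  proof -
    have "(\<Pi>\<^sub>E i\<in>{1..k}. \<Pi>\<^sub>E j\<in>{1..1::nat}. carrier (integer_mod_group (n i))) =
        (\<Pi>\<^sub>E i\<in>{1..k}. \<Pi>\<^sub>E j\<in>{1..1}. {0..<int (n i)})"
      using n1 by (intro PiE_cong) (force simp: carrier_integer_mod_group)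
    then show ?thesis
      by (cases p) (simp add: cyclic_product_def)
  qed
  define coef where "coef p s = (if s \<in> S0 then fst p (g' s) else snd p (h' s) 1)"
    for p :: "(nat \<Rightarrow> int) \<times> (nat \<Rightarrow> nat \<Rightarrow> int)" and s
  define \<Phi> where "\<Phi> p = lincomb z S (coef p)" for p
  have zc: "z s \<in> carrier G" if "s \<in> S" for s
    using z that by auto
  have "\<Phi> \<in> iso ?C G"
    unfolding iso_def bij_betw_def mem_Collect_eq
  proof (intro conjI)
    show "\<Phi> \<in> hom ?C G"
    proof (rule homI)
      show "\<Phi> p \<in> carrier G" for p
        unfolding \<Phi>_def using z by simp
      fix p q
      have "\<Phi> (p \<otimes>\<^bsub>?C\<^esub> q) = lincomb z S (\<lambda>s. coef p s + coef q s)"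
        unfolding \<Phi>_def
      proof (rule lincomb_cong_pow[OF z])
        fix s assume s: "s \<in> S"
        show "z s [^] coef (p \<otimes>\<^bsub>?C\<^esub> q) s = z s [^] (coef p s + coef q s)"
          using s g1[of s] h1[of s] int_pow_mod_ord[OF zc[OF s], of "coef p s + coef q s"]
          by (auto simp: coef_def cyclic_product_def mult_DirProd' n_def)
      qed
      then show "\<Phi> (p \<otimes>\<^bsub>?C\<^esub> q) = \<Phi> p \<otimes> \<Phi> q"
        by (simp add: \<Phi>_def lincomb_add[OF z])
    qed
    show "inj_on \<Phi> (carrier ?C)"
    proof (rule inj_onI)
      fix p q assume p: "p \<in> carrier ?C" and q: "q \<in> carrier ?C" and "\<Phi> p = \<Phi> q"
      then have "lincomb z S (\<lambda>s. coef p s - coef q s) = \<one>"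
        using lincomb_diff[OF z, of "coef p" "coef q"] z by (simp add: \<Phi>_def)
      then have "\<forall>s\<in>S. z s [^] (coef p s - coef q s) = \<one>"
        using ind unfolding indep_def by blast
      then have dvd: "int (ord (z s)) dvd coef p s - coef q s" if "s \<in> S" for s
        using that zc int_pow_eq_id by blast
      \<comment> \<open>The order is 0 here, and divisibility by 0 means that the difference is
        0.\<close>
      have eq1: "fst p i = fst q i" if "i \<in> {1..\<alpha>}" for i
        using dvd[OF g2(2)[OF that]] g2[OF that] by (auto simp: coef_def S0_def)
      have "fst p = fst q"
        using p q eq1 unfolding carr by (intro PiE_ext[of "fst p" "{1..\<alpha>}" "\<lambda>_. UNIV"]) blast+
      have eq2: "snd p i 1 = snd q i 1" if i: "i \<in> {1..k}" for i
      proof -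
        have "snd p i 1 \<in> {0..<int (n i)}" "snd q i 1 \<in> {0..<int (n i)}"
          using p q i unfolding carr by (auto dest!: PiE_mem[of "snd _"])
        moreover have "int (n i) dvd snd p i 1 - snd q i 1"
          using dvd[OF h2(1)[OF i]] h2[OF i] by (simp add: coef_def n_def)
        ultimately show ?thesis
          by (metis atLeastLessThan_iff mod_eq_dvd_iff mod_pos_pos_trivial)
      qed
      have eq3: "snd p i = snd q i" if i: "i \<in> {1..k}" for i
      proof (rule PiE_ext)
        show "snd p i \<in> {1..1} \<rightarrow>\<^sub>E {0..<int (n i)}" "snd q i \<in> {1..1} \<rightarrow>\<^sub>E {0..<int (n i)}"
          using p q i unfolding carr by (blast dest: PiE_mem)+
        show "snd p i j = snd q i j" if "j \<in> {1..1}" for j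
          using eq2[OF i] that by simp
      qed
      have "snd p = snd q"
      proof (rule PiE_ext)
        show "snd p \<in> (\<Pi>\<^sub>E i\<in>{1..k}. {1..1} \<rightarrow>\<^sub>E {0..<int (n i)})"
          "snd q \<in> (\<Pi>\<^sub>E i\<in>{1..k}. {1..1} \<rightarrow>\<^sub>E {0..<int (n i)})"
          using p q unfolding carr by blast+
      qed (rule eq3)
      with \<open>fst p = fst q\<close> show "p = q"
        by (simp add: prod_eq_iff)
    qed
    show "\<Phi> ` carrier ?C = carrier G"
    proof
      show "\<Phi> ` carrier ?C \<subseteq> carrier G"
        using z by (auto simp: \<Phi>_def)
      show "carrier G \<subseteq> \<Phi> ` carrier ?C"
      proof
        fix x assume "x \<in> carrier G"
        then obtain A where x: "x = lincomb z S A"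
          unfolding span[symmetric] by (rule lspanE)
        \<comment> \<open>The residues are needed to land in the carrier; by
          \<open>int_pow_mod_ord\<close> they give the same terms as the original
          coefficients.\<close>
        define p where
          "p = (\<lambda>i\<in>{1..\<alpha>}. A (g i), \<lambda>i\<in>{1..k}. \<lambda>j\<in>{1..1::nat}. A (h i) mod int (n i))"
        have "p \<in> carrier ?C"
          unfolding carr p_def using n1 by (force simp: PiE_iff extensional_def)
        moreover have "\<Phi> p = x"
          unfolding \<Phi>_def x
        proof (rule lincomb_cong_pow[OF z])
          fix s assume s: "s \<in> S"
          show "z s [^] coef p s = z s [^] A s"
            using s g1[of s] h1[of s] int_pow_mod_ord[OF zc[OF s], of "A s"]
            by (auto simp: coef_def p_def n_def)
        qed
        ultimately show "x \<in> \<Phi> ` carrier ?C"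
          by blast
      qed
    qed
  qed
  then have "?C \<cong> G"
    by (auto simp: is_iso_def)
  then have "G \<cong> ?C"
    by (rule group.iso_sym[OF group_cyclic_product])
  then show ?thesis
    using n1 by (intro exI[of _ \<alpha>] exI[of _ k] exI[of _ n] exI[of _ "\<lambda>_. 1"]) auto
qed

end

text \<open>\<open>group_n\<close> is a definite description, so its value can be computed only once
  some decomposition is known to exist.\<close>

lemma fg_comm_group_iso_cyclic_product:
  assumes "fg_comm_group M"
  shows "\<exists>\<alpha> k n \<beta>. (\<forall>i\<in>{1..k}. n i \<ge> 1 \<and> \<beta> i \<ge> 1) \<and> M \<cong> cyclic_product \<alpha> k n \<beta>"
proof -
  obtain S where S: "finite S" "S \<subseteq> carrier M" "generate M S = carrier M"
    using assms unfolding fg_comm_group_def by blast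
  interpret comm_group M
    using assms by (simp add: fg_comm_group_def)
  have "(\<lambda>s. s) \<in> S \<rightarrow> carrier M"
    using S(2) by auto
  then obtain z where z: "z \<in> S \<rightarrow> carrier M" "lspan z S = lspan (\<lambda>s. s) S" "indep z S"
    using ex_indep_same_span[OF S(1)] by blast
  have "lspan z S \<subseteq> carrier M"
    using z(1) by (auto elim!: lspanE)
  then have "lspan z S = carrier M"
    using generate_subset_lspan[OF S(1,2)] S(3) z(2) by simp
  then show ?thesis
    using ex_iso_cyclic_product[OF S(1) z(1) _ z(3)] by blast
qed

section \<open>Annihilators of finitely generated abelian groups\<close>

text \<open>Read off from a decomposition of \<open>M\<close>. The value 0 is excluded because it
  annihilates every group, also those with \<open>group_n M = \<infinity>\<close>.\<close>

lemma annihilates_iff_group_n: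
  assumes "fg_comm_group M" "m > 0"
  shows "annihilates m M \<longleftrightarrow> (\<exists>d. group_n M = enat d \<and> d dvd m)"
proof -
  have M: "group M"
    using assms(1) by (simp add: fg_comm_group_def comm_group_def)
  obtain \<alpha> k n \<beta> where *: "\<forall>i\<in>{1..k}. n i \<ge> 1 \<and> \<beta> i \<ge> 1" "M \<cong> cyclic_product \<alpha> k n \<beta>"
    using fg_comm_group_iso_cyclic_product[OF assms(1)] by blast
  have "annihilates m M \<longleftrightarrow> annihilates m (cyclic_product \<alpha> k n \<beta>)"
    by (rule annihilates_iso[OF M group_cyclic_product *(2)])
  then show ?thesis
    using annihilates_cyclic_product[OF *(1) assms(2)] group_n_eq[OF M *(2,1)] by auto
qed

lemma annihilates_cong_group_n:
  assumes "fg_comm_group M" "fg_comm_group N" "group_n M = group_n N"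
  shows "annihilates m M \<longleftrightarrow> annihilates m N"
proof (cases "m = 0")
  case True
  then show ?thesis
    by (simp add: annihilates_def)
next
  case False
  then show ?thesis
    using assms by (simp add: annihilates_iff_group_n)
qed


section \<open>Tensions and potentials\<close>

lemma bidirected_simps [simp]:
  "verts (bidirected G) = verts G"
  "arcs (bidirected G) = arcs G \<times> UNIV"
  "tail (bidirected G) (e, d) = (if d then tail G e else head G e)"
  "head (bidirected G) (e, d) = (if d then head G e else tail G e)"
  by (simp_all add: bidirected_def)

lemma wf_digraph_bidirected: "wf_digraph G \<Longrightarrow> wf_digraph (bidirected G)"
  by (auto simp: wf_digraph_def)

lemma circuit_pos_neg_simps [simp]:
  "circuit_pos [] = {}" "circuit_neg [] = {}"
  "circuit_pos ((e, True) # p) = insert e (circuit_pos p)"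
  "circuit_neg ((e, True) # p) = circuit_neg p"
  "circuit_pos ((e, False) # p) = circuit_pos p"
  "circuit_neg ((e, False) # p) = insert e (circuit_neg p)"
  by (auto simp: circuit_pos_def circuit_neg_def)

lemma circuit_pos_subset: "circuit_pos p \<subseteq> fst ` set p"
  and circuit_neg_subset: "circuit_neg p \<subseteq> fst ` set p"
  by (force simp: circuit_pos_def circuit_neg_def)+

lemma Pi_circuit_pos: "f \<in> fst ` set p \<rightarrow> X \<Longrightarrow> f \<in> circuit_pos p \<rightarrow> X"
  and Pi_circuit_neg: "f \<in> fst ` set p \<rightarrow> X \<Longrightarrow> f \<in> circuit_neg p \<rightarrow> X"
  unfolding Pi_iff by (meson circuit_pos_subset circuit_neg_subset subsetD)+

lemma finite_circuit_pos [simp]: "finite (circuit_pos p)"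
  and finite_circuit_neg [simp]: "finite (circuit_neg p)"
  by (meson List.finite_set finite_imageI finite_subset circuit_pos_subset circuit_neg_subset)+

lemma circuit_arcs: "circuit G C \<Longrightarrow> fst ` set C \<subseteq> arcs G"
  by (auto simp: circuit_def pre_digraph.cycle_def pre_digraph.awalk_def)

section \<open>Potential differences are tensions\<close>

text \<open>Telescoping: a forward arc contributes to the left side, a backward arc to the right
  side, and each step moves the potential on to the next vertex. Distinctness lets the two sets
  count every traversal. The potential equation is asked on the arcs of the walk only, so the lemma
  also serves for potentials that fit just part of the arcs.\<close>

lemma finprod_along_walk:
  assumes "comm_group M" "wf_digraph G" "\<phi> \<in> verts G \<rightarrow> carrier M"
    and "pre_digraph.awalk (bidirected G) u p v" "distinct (map fst p)"
    and "\<And>e. e \<in> fst ` set p \<Longrightarrow> \<tau> e \<in> carrier M"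
    and "\<And>e. e \<in> fst ` set p \<Longrightarrow> \<tau> e \<otimes>\<^bsub>M\<^esub> \<phi> (tail G e) = \<phi> (head G e)"
  shows "finprod M \<tau> (circuit_pos p) \<otimes>\<^bsub>M\<^esub> \<phi> u = finprod M \<tau> (circuit_neg p) \<otimes>\<^bsub>M\<^esub> \<phi> v"
  using assms(4-)
proof (induction p arbitrary: u)
  case Nil
  interpret wf_digraph "bidirected G"
    using assms(2) by (rule wf_digraph_bidirected)
  interpret comm_group M by fact
  show ?case
    using Nil by (auto simp: awalk_Nil_iff)
next
  case (Cons s p)
  interpret B: wf_digraph "bidirected G"
    using assms(2) by (rule wf_digraph_bidirected)
  interpret G: wf_digraph G by fact
  interpret comm_group M by fact
  obtain e d where s: "s = (e, d)"
    by (cases s)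
  have u: "u = tail (bidirected G) s" and walk: "B.awalk (head (bidirected G) s) p v"
    and e: "e \<in> arcs G"
    using Cons.prems(1) by (auto simp: B.awalk_Cons_iff s)
  have "e \<notin> fst ` set p"
    using Cons.prems(2) by (simp add: s)
  then have ne: "e \<notin> circuit_pos p" "e \<notin> circuit_neg p"
    using circuit_pos_subset[of p] circuit_neg_subset[of p] by auto
  have \<tau>p: "\<tau> \<in> circuit_pos p \<rightarrow> carrier M" "\<tau> \<in> circuit_neg p \<rightarrow> carrier M"
    using Cons.prems(3) by (intro Pi_circuit_pos Pi_circuit_neg funcsetI; simp)+
  have \<tau>e: "\<tau> e \<in> carrier M" "\<tau> e \<otimes>\<^bsub>M\<^esub> \<phi> (tail G e) = \<phi> (head G e)"
    using Cons.prems(3,4)[of e] by (auto simp: s)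
  have \<phi>e: "\<phi> (tail G e) \<in> carrier M" "\<phi> (head G e) \<in> carrier M"
    using assms(3) e by auto
  have \<phi>v: "\<phi> v \<in> carrier M"
    using assms(3) B.awalk_last_in_verts[OF walk] by auto
  have IH: "finprod M \<tau> (circuit_pos p) \<otimes>\<^bsub>M\<^esub> \<phi> (head (bidirected G) s) =
      finprod M \<tau> (circuit_neg p) \<otimes>\<^bsub>M\<^esub> \<phi> v"
    using Cons.prems by (intro Cons.IH walk) auto
  note fp = finprod_closed[OF \<tau>p(1)] finprod_closed[OF \<tau>p(2)]
  show ?case
  proof (cases d)
    case True
    have "(\<tau> e \<otimes>\<^bsub>M\<^esub> finprod M \<tau> (circuit_pos p)) \<otimes>\<^bsub>M\<^esub> \<phi> (tail G e) =
        finprod M \<tau> (circuit_pos p) \<otimes>\<^bsub>M\<^esub> (\<tau> e \<otimes>\<^bsub>M\<^esub> \<phi> (tail G e))"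
      using fp \<tau>e(1) \<phi>e by (simp add: m_ac)
    then show ?thesis
      using IH ne \<tau>p \<tau>e True by (simp add: s u)
  next
    case False
    have "finprod M \<tau> (circuit_pos p) \<otimes>\<^bsub>M\<^esub> \<phi> (head G e) =
        \<tau> e \<otimes>\<^bsub>M\<^esub> (finprod M \<tau> (circuit_pos p) \<otimes>\<^bsub>M\<^esub> \<phi> (tail G e))"
      unfolding \<tau>e(2)[symmetric] using fp \<tau>e(1) \<phi>e by (simp add: m_ac)
    then show ?thesis
      using IH ne \<tau>p \<tau>e(1) False fp \<phi>v by (simp add: s u m_assoc)
  qed
qed

text \<open>On a closed walk the two end potentials in \<open>finprod_along_walk\<close> coincide
  and cancel.\<close>

lemma potential_difference_tension:
  assumes "comm_group M" "wf_digraph G" "\<phi> \<in> verts G \<rightarrow> carrier M" "\<tau> \<in> arcs G \<rightarrow> carrier M"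
    and "\<And>e. e \<in> arcs G \<Longrightarrow> \<tau> e \<otimes>\<^bsub>M\<^esub> \<phi> (tail G e) = \<phi> (head G e)"
  shows "tension M G \<tau>"
  unfolding tension_def
proof (intro conjI allI impI)
  interpret comm_group M by fact
  interpret B: wf_digraph "bidirected G"
    using assms(2) by (rule wf_digraph_bidirected)
  fix C assume C: "circuit G C"
  have arcs: "fst ` set C \<subseteq> arcs G"
    by (rule circuit_arcs[OF C])
  obtain u where u: "B.awalk u C u" "distinct (map fst C)"
    using C by (auto simp: circuit_def B.cycle_def)
  have \<tau>C: "\<tau> \<in> fst ` set C \<rightarrow> carrier M"
    using funcset_mem[OF assms(4)] arcs by (intro funcsetI) (meson subsetD)
  have "finprod M \<tau> (circuit_pos C) \<otimes>\<^bsub>M\<^esub> \<phi> u = finprod M \<tau> (circuit_neg C) \<otimes>\<^bsub>M\<^esub> \<phi> u"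
    by (intro finprod_along_walk[OF assms(1-3) u] funcset_mem[OF \<tau>C] assms(5))
      (erule subsetD[OF arcs] | assumption)+
  moreover have "\<phi> u \<in> carrier M"
    using B.awalk_hd_in_verts[OF u(1)] by (intro funcset_mem[OF assms(3)]) simp
  ultimately show "finprod M \<tau> (circuit_pos C) = finprod M \<tau> (circuit_neg C)"
    using right_cancel finprod_closed[OF Pi_circuit_pos[OF \<tau>C]] finprod_closed[OF Pi_circuit_neg[OF \<tau>C]]
    by metis
qed fact

section \<open>Every tension is a potential difference\<close>

text \<open>If an arc occurred again later, in either direction, the start of its first traversal
  would be one of its ends and so be visited again.\<close>

lemma distinct_verts_imp_distinct_arcs:
  assumes "wf_digraph G" "pre_digraph.awalk (bidirected G) u p v"
    and "distinct (pre_digraph.awalk_verts (bidirected G) u p)"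
  shows "distinct (map fst p)"
  using assms(2,3)
proof (induction p arbitrary: u)
  case (Cons s p)
  interpret wf_digraph "bidirected G"
    using assms(1) by (rule wf_digraph_bidirected)
  have walk: "awalk (head (bidirected G) s) p v"
    using Cons.prems(1) by (simp add: awalk_Cons_iff)
  have "fst s \<notin> fst ` set p"
  proof
    assume "fst s \<in> fst ` set p"
    then obtain t where t: "t \<in> set p" "fst t = fst s"
      by (metis imageE)
    have "tail (bidirected G) s \<in> {tail (bidirected G) t, head (bidirected G) t}"
      using t(2) by (cases s, cases t) simp
    then have "tail (bidirected G) s \<in> set (awalk_verts (head (bidirected G) s) p)"
      using awalk_verts_arc1[OF t(1)] awalk_verts_arc2[OF walk t(1)] by (metis insertE singletonD)
    then show False
      using Cons.prems(2) by simp
  qed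
  then show ?case
    using Cons.IH[OF walk] Cons.prems(2) by simp
qed simp

text \<open>\<open>cas\<close> consults tails and heads only. A path in the digraph restricted to
  some of the arcs can therefore be read as a path in the full one.\<close>

lemma cas_bidirected_arcs_update:
  "pre_digraph.cas (bidirected (G\<lparr>arcs := A\<rparr>)) u p v \<longleftrightarrow> pre_digraph.cas (bidirected G) u p v"
proof (induction p arbitrary: u)
  case (Cons s p)
  then show ?case
    by (cases s) (simp add: pre_digraph.cas.simps)
qed (simp add: pre_digraph.cas.simps)

lemma awalk_verts_bidirected_arcs_update:
  "pre_digraph.awalk_verts (bidirected (G\<lparr>arcs := A\<rparr>)) u p = pre_digraph.awalk_verts (bidirected G) u p"
proof (induction p arbitrary: u)
  case (Cons s p)
  then show ?case
    by (cases s) (simp add: pre_digraph.awalk_verts.simps)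
qed (simp add: pre_digraph.awalk_verts.simps)

text \<open>Arcs are added one at a time. If arcs of \<open>A\<close> already connect the ends of
  the new arc, the circuit that it closes forces its potential equation; otherwise the potential on
  the component of its head can be shifted until the equation holds.\<close>

lemma ex_potential_on:
  assumes "comm_group M" "wf_digraph G" "tension M G \<tau>" "finite A" "A \<subseteq> arcs G"
  shows "\<exists>\<phi> \<in> verts G \<rightarrow> carrier M. \<forall>e\<in>A. \<tau> e \<otimes>\<^bsub>M\<^esub> \<phi> (tail G e) = \<phi> (head G e)"
  using assms(4,5)
proof (induction A rule: finite_induct)
  case empty
  interpret comm_group M by fact
  show ?case
    by (intro bexI[of _ "\<lambda>_. \<one>\<^bsub>M\<^esub>"]) auto
next
  case (insert e A)
  interpret comm_group M by fact
  interpret G: wf_digraph G by fact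
  let ?B = "bidirected (G\<lparr>arcs := A\<rparr>)"
  have "wf_digraph (G\<lparr>arcs := A\<rparr>)"
    using insert.prems by (auto simp: wf_digraph_def)
  then interpret B: wf_digraph ?B
    by (rule wf_digraph_bidirected)
  interpret D: wf_digraph "bidirected G"
    using assms(2) by (rule wf_digraph_bidirected)
  obtain \<phi> where \<phi>: "\<phi> \<in> verts G \<rightarrow> carrier M"
    and pot: "\<And>a. a \<in> A \<Longrightarrow> \<tau> a \<otimes>\<^bsub>M\<^esub> \<phi> (tail G a) = \<phi> (head G a)"
    using insert by auto
  have \<tau>: "\<And>a. a \<in> arcs G \<Longrightarrow> \<tau> a \<in> carrier M"
    using assms(3) by (auto simp: tension_def)
  have e: "e \<in> arcs G"
    using insert.prems by simp
  define u v where "u = tail G e" and "v = head G e"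
  have uv: "\<phi> u \<in> carrier M" "\<phi> v \<in> carrier M"
    using \<phi> e by (auto simp: u_def v_def)
  show ?case
  proof (cases "\<exists>p. B.awalk v p u")
    case True
    \<comment> \<open>A path is taken instead of a walk, so that closing it by \<open>e\<close>
      repeats no vertex and gives a circuit. For a loop \<open>e\<close> the path is empty.\<close>
    then obtain p where p: "B.apath v p u"
      using B.reachable_awalk B.reachable_apath by blast
    have pA: "fst ` set p \<subseteq> A"
      using p by (auto simp: B.apath_def B.awalk_def)
    then have parcs: "fst ` set p \<subseteq> arcs G"
      using insert.prems by auto
    have walk: "D.awalk v p u"
      using p parcs unfolding B.apath_def B.awalk_def D.awalk_def cas_bidirected_arcs_update
      by (auto simp: image_subset_iff)
    have dv: "distinct (D.awalk_verts v p)"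
      using p by (simp add: B.apath_def awalk_verts_bidirected_arcs_update)
    have dp: "distinct (map fst p)"
      by (rule distinct_verts_imp_distinct_arcs[OF assms(2) walk dv])
    have "circuit G ((e, True) # p)"
      unfolding circuit_def D.cycle_def
    proof (intro conjI exI)
      show "D.awalk u ((e, True) # p) u"
        using walk e by (simp add: D.awalk_Cons_iff u_def v_def)
      show "distinct (tl (D.awalk_verts u ((e, True) # p)))"
        using dv by (simp add: v_def)
      show "distinct (map fst ((e, True) # p))"
        using dp pA insert.hyps(2) by auto
    qed simp
    then have circ: "finprod M \<tau> (insert e (circuit_pos p)) = finprod M \<tau> (circuit_neg p)"
      using assms(3) unfolding tension_def by (metis circuit_pos_neg_simps(3,4))
    have \<tau>_walk: "\<tau> \<in> fst ` set p \<rightarrow> carrier M"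
      using \<tau> parcs by (intro funcsetI) (meson subsetD)
    note \<tau>p = Pi_circuit_pos[OF \<tau>_walk] Pi_circuit_neg[OF \<tau>_walk]
    have "e \<notin> circuit_pos p"
      using pA insert.hyps(2) circuit_pos_subset[of p] by blast
    then have "\<tau> e \<otimes>\<^bsub>M\<^esub> finprod M \<tau> (circuit_pos p) = finprod M \<tau> (circuit_neg p)"
      using circ \<tau>[OF e] \<tau>p by simp
    moreover have "finprod M \<tau> (circuit_pos p) \<otimes>\<^bsub>M\<^esub> \<phi> v = finprod M \<tau> (circuit_neg p) \<otimes>\<^bsub>M\<^esub> \<phi> u"
      by (intro finprod_along_walk[OF assms(1,2) \<phi> walk dp] funcset_mem[OF \<tau>_walk] pot)
        (erule subsetD[OF pA] | assumption)+
    moreover have "finprod M \<tau> (circuit_pos p) \<otimes>\<^bsub>M\<^esub> (\<tau> e \<otimes>\<^bsub>M\<^esub> \<phi> u) =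
        (\<tau> e \<otimes>\<^bsub>M\<^esub> finprod M \<tau> (circuit_pos p)) \<otimes>\<^bsub>M\<^esub> \<phi> u"
      using uv \<tau>[OF e] finprod_closed[OF \<tau>p(1)] by (simp add: m_ac)
    ultimately have "finprod M \<tau> (circuit_pos p) \<otimes>\<^bsub>M\<^esub> (\<tau> e \<otimes>\<^bsub>M\<^esub> \<phi> u) =
        finprod M \<tau> (circuit_pos p) \<otimes>\<^bsub>M\<^esub> \<phi> v"
      by simp
    then have "\<tau> e \<otimes>\<^bsub>M\<^esub> \<phi> u = \<phi> v"
      using uv \<tau>[OF e] finprod_closed[OF \<tau>p(1)] by simp
    then show ?thesis
      using \<phi> pot by (auto simp: u_def v_def)
  next
    case False
    \<comment> \<open>The component of the head of \<open>e\<close> in the underlying undirected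
      graph with arc set \<open>A\<close>.\<close>
    define R where "R = {w. \<exists>p. B.awalk v p w}"
    have "B.awalk v [] v"
      using e by (simp add: B.awalk_Nil_iff v_def)
    then have "v \<in> R"
      unfolding R_def by blast
    have "u \<notin> R"
      using False by (simp add: R_def)
    have R_step: "head ?B s \<in> R" if s: "s \<in> arcs ?B" and tl: "tail ?B s \<in> R" for s
    proof -
      obtain p where "B.awalk v p (tail ?B s)"
        using tl by (auto simp: R_def)
      then have "B.awalk v (p @ [s]) (head ?B s)"
        by (rule B.awalk_appendI) (rule B.arc_implies_awalk[OF s])
      then show ?thesis
        unfolding R_def by blast
    qed
    have R_iff: "tail G a \<in> R \<longleftrightarrow> head G a \<in> R" if "a \<in> A" for a
      using R_step[of "(a, True)"] R_step[of "(a, False)"] that by auto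
    \<comment> \<open>Solves the equation at \<open>e\<close>: it makes
      \<open>c \<otimes> \<phi> v\<close> equal to \<open>\<tau> e \<otimes> \<phi> u\<close>, and
      \<open>\<phi> u\<close> stays unchanged as \<open>u\<close> is outside \<open>R\<close>. Arcs
      of \<open>A\<close> keep their equations, since by \<open>R_iff\<close> both ends are
      multiplied or neither is.\<close>
    define c where "c = \<tau> e \<otimes>\<^bsub>M\<^esub> \<phi> u \<otimes>\<^bsub>M\<^esub> inv\<^bsub>M\<^esub> \<phi> v"
    have c: "c \<in> carrier M"
      using uv \<tau>[OF e] by (simp add: c_def)
    define \<psi> where "\<psi> w = (if w \<in> R then c \<otimes>\<^bsub>M\<^esub> \<phi> w else \<phi> w)" for w
    have "\<psi> \<in> verts G \<rightarrow> carrier M"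
      using \<phi> c by (auto simp: \<psi>_def Pi_iff)
    moreover have "\<tau> e \<otimes>\<^bsub>M\<^esub> \<psi> (tail G e) = \<psi> (head G e)"
      using \<open>v \<in> R\<close> \<open>u \<notin> R\<close> uv \<tau>[OF e]
      by (simp add: \<psi>_def c_def m_assoc flip: u_def v_def)
    moreover have "\<tau> a \<otimes>\<^bsub>M\<^esub> \<psi> (tail G a) = \<psi> (head G a)" if a: "a \<in> A" for a
    proof -
      have "a \<in> arcs G"
        using a insert.prems by auto
      then have "\<phi> (tail G a) \<in> carrier M" "\<tau> a \<in> carrier M"
        using \<phi> \<tau> by auto
      then have "\<tau> a \<otimes>\<^bsub>M\<^esub> (c \<otimes>\<^bsub>M\<^esub> \<phi> (tail G a)) = c \<otimes>\<^bsub>M\<^esub> \<phi> (head G a)"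
        unfolding pot[OF a, symmetric] using c by (rule_tac m_lcomm) auto
      then show ?thesis
        using pot[OF a] R_iff[OF a] by (simp add: \<psi>_def)
    qed
    ultimately show ?thesis
      by auto
  qed
qed

section \<open>Boundaries of image chains\<close>

text \<open>
  The vertex \<open>w\<close> of \<open>H\<close> is entered \<open>inflow H f C w\<close> times and left \<open>outflow H f C w\<close> times by the
  image of the circuit \<open>C\<close> under \<open>f\<close>, which need not be a walk.
\<close>

definition inflow :: "('c, 'd) pre_digraph \<Rightarrow> ('b \<Rightarrow> 'd) \<Rightarrow> ('b \<times> bool) list \<Rightarrow> 'c \<Rightarrow> nat" where
  "inflow H f C w = card {e \<in> circuit_pos C. head H (f e) = w} + card {e \<in> circuit_neg C. tail H (f e) = w}"

definition outflow :: "('c, 'd) pre_digraph \<Rightarrow> ('b \<Rightarrow> 'd) \<Rightarrow> ('b \<times> bool) list \<Rightarrow> 'c \<Rightarrow> nat" where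
  "outflow H f C w = card {e \<in> circuit_pos C. tail H (f e) = w} + card {e \<in> circuit_neg C. head H (f e) = w}"

text \<open>Equal factors are collected into powers. This converts products over arcs into products
  over vertices, with exponents that count arcs.\<close>

lemma (in comm_group) finprod_fibres:
  assumes "finite P" "finite V" "g \<in> P \<rightarrow> V" "\<phi> \<in> V \<rightarrow> carrier G"
  shows "(\<Otimes>e\<in>P. \<phi> (g e)) = (\<Otimes>v\<in>V. \<phi> v [^] card {e \<in> P. g e = v})"
  using assms(1,3)
proof (induction P rule: finite_induct)
  case (insert e P)
  have ge: "g e \<in> V" "\<phi> (g e) \<in> carrier G"
    using insert.prems assms(4) by auto
  \<comment> \<open>The new element raises only the exponent at \<open>g e\<close>, by one, so a
    factor concentrated at \<open>g e\<close> splits off.\<close>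
  have "(\<Otimes>v\<in>V. \<phi> v [^] card {e' \<in> insert e P. g e' = v}) =
      (\<Otimes>v\<in>V. (if v = g e then \<phi> v else \<one>) \<otimes> \<phi> v [^] card {e' \<in> P. g e' = v})"
  proof (intro finprod_cong')
    fix v assume v: "v \<in> V"
    have "{e' \<in> insert e P. g e' = v} = (if g e = v then insert e {e' \<in> P. g e' = v} else {e' \<in> P. g e' = v})"
      by auto
    then show "\<phi> v [^] card {e' \<in> insert e P. g e' = v} =
        (if v = g e then \<phi> v else \<one>) \<otimes> \<phi> v [^] card {e' \<in> P. g e' = v}"
      using insert.hyps funcset_mem[OF assms(4) v] by (auto simp: m_comm)
  qed (use assms(4) ge in \<open>auto simp: Pi_iff\<close>)
  also have "\<dots> = (\<Otimes>v\<in>V. if v = g e then \<phi> v else \<one>) \<otimes> (\<Otimes>v\<in>V. \<phi> v [^] card {e' \<in> P. g e' = v})"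
    using assms(4) by (intro finprod_multf) (auto simp: Pi_iff)
  also have "(\<Otimes>v\<in>V. if v = g e then \<phi> v else \<one>) = \<phi> (g e)"
    by (rule finprod_singleton_swap[OF ge(1) assms(2,4)])
  also have "(\<Otimes>v\<in>V. \<phi> v [^] card {e' \<in> P. g e' = v}) = (\<Otimes>e\<in>P. \<phi> (g e))"
    using insert by auto
  finally show ?case
    using insert.hyps insert.prems assms(4) ge by (subst finprod_insert) (auto simp: Pi_iff)
qed simp

text \<open>By the potential equation, a product over heads is the product of \<tau> times the
  product over tails. So the inflow product is the product of \<tau> over
  \<open>circuit_pos C\<close> times a remainder, the outflow product is that over
  \<open>circuit_neg C\<close> times the same remainder, and the remainder cancels.\<close>

lemma finprod_potential_difference:
  assumes "comm_group M" "fin_digraph H" "\<phi> \<in> verts H \<rightarrow> carrier M" "\<tau> \<in> arcs H \<rightarrow> carrier M"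
    and pot: "\<And>e. e \<in> arcs H \<Longrightarrow> \<tau> e \<otimes>\<^bsub>M\<^esub> \<phi> (tail H e) = \<phi> (head H e)"
    and f: "f \<in> fst ` set C \<rightarrow> arcs H"
  shows "finprod M (\<tau> \<circ> f) (circuit_pos C) = finprod M (\<tau> \<circ> f) (circuit_neg C) \<longleftrightarrow>
    finprod M (\<lambda>w. \<phi> w [^]\<^bsub>M\<^esub> inflow H f C w) (verts H) =
    finprod M (\<lambda>w. \<phi> w [^]\<^bsub>M\<^esub> outflow H f C w) (verts H)"
proof -
  interpret comm_group M by fact
  interpret H: fin_digraph H by fact
  let ?P = "circuit_pos C" and ?N = "circuit_neg C"
  let ?T = "\<lambda>X. finprod M (\<tau> \<circ> f) X"
  let ?hd = "\<lambda>X. finprod M (\<lambda>e. \<phi> (head H (f e))) X"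
  let ?tl = "\<lambda>X. finprod M (\<lambda>e. \<phi> (tail H (f e))) X"
  have fP: "f \<in> ?P \<rightarrow> arcs H" and fN: "f \<in> ?N \<rightarrow> arcs H"
    using f by (rule Pi_circuit_pos, rule Pi_circuit_neg)
  have cl: "?T X \<in> carrier M" "?hd X \<in> carrier M" "?tl X \<in> carrier M" if "f \<in> X \<rightarrow> arcs H" for X
    using that assms(3,4) by (auto intro!: finprod_closed simp: Pi_iff)
  have T: "?T X \<otimes>\<^bsub>M\<^esub> ?tl X = ?hd X" if "f \<in> X \<rightarrow> arcs H" for X
  proof -
    have "?T X \<otimes>\<^bsub>M\<^esub> ?tl X = finprod M (\<lambda>e. (\<tau> \<circ> f) e \<otimes>\<^bsub>M\<^esub> \<phi> (tail H (f e))) X"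
      using that assms(3,4) by (subst finprod_multf) (auto simp: Pi_iff)
    also have "\<dots> = ?hd X"
      using that assms(3) pot by (intro finprod_cong') (auto simp: Pi_iff)
    finally show ?thesis .
  qed
  have fib: "finprod M (\<lambda>e. \<phi> (g (f e))) X = finprod M (\<lambda>w. \<phi> w [^]\<^bsub>M\<^esub> card {e \<in> X. g (f e) = w}) (verts H)"
    if "f \<in> X \<rightarrow> arcs H" "g \<in> arcs H \<rightarrow> verts H" "finite X" for X g
    using finprod_fibres[OF that(3) H.finite_verts _ assms(3), of "\<lambda>e. g (f e)"] that by auto
  have ht: "head H \<in> arcs H \<rightarrow> verts H" "tail H \<in> arcs H \<rightarrow> verts H"
    by auto
  have pow: "(\<lambda>w. \<phi> w [^]\<^bsub>M\<^esub> (k w :: nat)) \<in> verts H \<rightarrow> carrier M" for k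
    using assms(3) by auto
  have mult: "finprod M (\<lambda>w. \<phi> w [^]\<^bsub>M\<^esub> (k w + l w)) (verts H) =
      finprod M (\<lambda>w. \<phi> w [^]\<^bsub>M\<^esub> k w) (verts H) \<otimes>\<^bsub>M\<^esub> finprod M (\<lambda>w. \<phi> w [^]\<^bsub>M\<^esub> l w) (verts H)" for k l :: "_ \<Rightarrow> nat"
  proof -
    have "finprod M (\<lambda>w. \<phi> w [^]\<^bsub>M\<^esub> (k w + l w)) (verts H) =
        finprod M (\<lambda>w. \<phi> w [^]\<^bsub>M\<^esub> k w \<otimes>\<^bsub>M\<^esub> \<phi> w [^]\<^bsub>M\<^esub> l w) (verts H)"
      using assms(3) by (intro finprod_cong') (auto simp: nat_pow_mult Pi_iff)
    then show ?thesis
      using finprod_multf[OF pow pow] by simp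
  qed
  have "finprod M (\<lambda>w. \<phi> w [^]\<^bsub>M\<^esub> inflow H f C w) (verts H) = ?hd ?P \<otimes>\<^bsub>M\<^esub> ?tl ?N"
    using fib[OF fP ht(1)] fib[OF fN ht(2)] by (simp add: inflow_def mult)
  also have "\<dots> = ?T ?P \<otimes>\<^bsub>M\<^esub> (?tl ?P \<otimes>\<^bsub>M\<^esub> ?tl ?N)"
    using cl[OF fP] cl[OF fN] by (simp flip: T[OF fP] add: m_assoc)
  finally have inflow: "finprod M (\<lambda>w. \<phi> w [^]\<^bsub>M\<^esub> inflow H f C w) (verts H) =
      ?T ?P \<otimes>\<^bsub>M\<^esub> (?tl ?P \<otimes>\<^bsub>M\<^esub> ?tl ?N)" .
  have "finprod M (\<lambda>w. \<phi> w [^]\<^bsub>M\<^esub> outflow H f C w) (verts H) = ?tl ?P \<otimes>\<^bsub>M\<^esub> ?hd ?N"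
    using fib[OF fP ht(2)] fib[OF fN ht(1)] by (simp add: outflow_def mult)
  also have "\<dots> = ?T ?N \<otimes>\<^bsub>M\<^esub> (?tl ?P \<otimes>\<^bsub>M\<^esub> ?tl ?N)"
    using cl[OF fP] cl[OF fN] by (simp flip: T[OF fN] add: m_lcomm)
  finally have outflow: "finprod M (\<lambda>w. \<phi> w [^]\<^bsub>M\<^esub> outflow H f C w) (verts H) =
      ?T ?N \<otimes>\<^bsub>M\<^esub> (?tl ?P \<otimes>\<^bsub>M\<^esub> ?tl ?N)" .
  show ?thesis
    unfolding inflow outflow using cl[OF fP] cl[OF fN] by (intro right_cancel[symmetric] m_closed)
qed

section \<open>The annihilator criterion for tension-continuity\<close>

text \<open>By truncation, \<open>(i - j) + (j - i)\<close> is the distance of \<open>i\<close> and \<open>j\<close>.\<close>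

lemma (in group) pow_eq_pow_iff_annihilates:
  fixes i j :: nat
  shows "(\<forall>x\<in>carrier G. x [^] i = x [^] j) \<longleftrightarrow> annihilates ((i - j) + (j - i)) G"
proof -
  have *: "x [^] i = x [^] j \<longleftrightarrow> x [^] (j - i) = \<one>" if "i \<le> j" "x \<in> carrier G" for i j :: nat and x
    using that nat_pow_mult[of x "j - i" i] by (metis le_add_diff_inverse2 nat_pow_closed r_cancel_one)
  show ?thesis
  proof (cases "i \<le> j")
    case True
    then show ?thesis
      using *[OF True] by (auto simp: annihilates_def)
  next
    case False
    then show ?thesis
      using *[of j i] by (auto simp: annihilates_def eq_commute)
  qed
qed

text \<open>A potential concentrated at \<open>w\<close> isolates the condition at \<open>w\<close>.
  Conversely, every tension on \<open>H\<close> has a potential, and the inflow and outflow products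
  then agree factor by factor. The right side sees \<open>M\<close> only through
  \<open>annihilates\<close>, which makes groups of different types comparable.\<close>

lemma tension_continuous_iff_annihilates:
  assumes "comm_group M" "fin_digraph H"
  shows "tension_continuous M G H f \<longleftrightarrow> f \<in> arcs G \<rightarrow> arcs H \<and>
    (\<forall>C. circuit G C \<longrightarrow> (\<forall>w\<in>verts H. annihilates
      ((inflow H f C w - outflow H f C w) + (outflow H f C w - inflow H f C w)) M))"
proof -
  interpret comm_group M by fact
  interpret H: fin_digraph H by fact
  have "x [^]\<^bsub>M\<^esub> inflow H f C w = x [^]\<^bsub>M\<^esub> outflow H f C w"
    if f: "f \<in> arcs G \<rightarrow> arcs H" and tc: "\<And>\<tau>. tension M H \<tau> \<Longrightarrow> tension M G (\<tau> \<circ> f)"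
      and C: "circuit G C" and w: "w \<in> verts H" and x: "x \<in> carrier M" for C w x
  proof -
    define \<phi> where "\<phi> v = (if v = w then x else \<one>\<^bsub>M\<^esub>)" for v
    define \<tau> where "\<tau> e = \<phi> (head H e) \<otimes>\<^bsub>M\<^esub> inv\<^bsub>M\<^esub> \<phi> (tail H e)" for e
    have \<phi>: "\<phi> v \<in> carrier M" for v
      using x by (simp add: \<phi>_def)
    have \<phi>': "\<phi> \<in> verts H \<rightarrow> carrier M" and \<tau>: "\<tau> \<in> arcs H \<rightarrow> carrier M"
      using \<phi> by (auto simp: \<tau>_def)
    have pot: "\<tau> e \<otimes>\<^bsub>M\<^esub> \<phi> (tail H e) = \<phi> (head H e)" for e
      using \<phi> by (simp add: \<tau>_def m_assoc)
    have "tension M H \<tau>"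
      by (rule potential_difference_tension[OF assms(1) H.wf_digraph \<phi>' \<tau> pot])
    then have "finprod M (\<tau> \<circ> f) (circuit_pos C) = finprod M (\<tau> \<circ> f) (circuit_neg C)"
      using tc C unfolding tension_def by blast
    moreover have "f \<in> fst ` set C \<rightarrow> arcs H"
      using f circuit_arcs[OF C] by auto
    ultimately have "finprod M (\<lambda>v. \<phi> v [^]\<^bsub>M\<^esub> inflow H f C v) (verts H) =
        finprod M (\<lambda>v. \<phi> v [^]\<^bsub>M\<^esub> outflow H f C v) (verts H)"
      using finprod_potential_difference[OF assms \<phi>' \<tau> pot] by blast
    moreover have "finprod M (\<lambda>v. \<phi> v [^]\<^bsub>M\<^esub> (k v :: nat)) (verts H) = x [^]\<^bsub>M\<^esub> k w" for k
    proof -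
      have "finprod M (\<lambda>v. \<phi> v [^]\<^bsub>M\<^esub> k v) (verts H) =
          finprod M (\<lambda>v. if v = w then x [^]\<^bsub>M\<^esub> k v else \<one>\<^bsub>M\<^esub>) (verts H)"
        using x by (intro finprod_cong') (auto simp: \<phi>_def)
      also have "\<dots> = x [^]\<^bsub>M\<^esub> k w"
        using x by (intro finprod_singleton_swap w) auto
      finally show ?thesis .
    qed
    ultimately show ?thesis
      by simp
  qed
  moreover have "tension M G (\<tau> \<circ> f)"
    if f: "f \<in> arcs G \<rightarrow> arcs H" and \<tau>: "tension M H \<tau>"
      and pow: "\<And>C w x. \<lbrakk>circuit G C; w \<in> verts H; x \<in> carrier M\<rbrakk> \<Longrightarrow>
        x [^]\<^bsub>M\<^esub> inflow H f C w = x [^]\<^bsub>M\<^esub> outflow H f C w" for \<tau>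
  proof -
    have \<tau>c: "\<tau> \<in> arcs H \<rightarrow> carrier M"
      using \<tau> by (simp add: tension_def)
    obtain \<phi> where \<phi>: "\<phi> \<in> verts H \<rightarrow> carrier M"
      and pot: "\<And>e. e \<in> arcs H \<Longrightarrow> \<tau> e \<otimes>\<^bsub>M\<^esub> \<phi> (tail H e) = \<phi> (head H e)"
      using ex_potential_on[OF assms(1) H.wf_digraph \<tau> H.finite_arcs subset_refl] by blast
    have "finprod M (\<tau> \<circ> f) (circuit_pos C) = finprod M (\<tau> \<circ> f) (circuit_neg C)" if C: "circuit G C" for C
    proof -
      have "f \<in> fst ` set C \<rightarrow> arcs H"
        using f circuit_arcs[OF C] by auto
      moreover have "finprod M (\<lambda>v. \<phi> v [^]\<^bsub>M\<^esub> inflow H f C v) (verts H) =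
          finprod M (\<lambda>v. \<phi> v [^]\<^bsub>M\<^esub> outflow H f C v) (verts H)"
        using \<phi> pow[OF C] by (intro finprod_cong') auto
      ultimately show ?thesis
        using finprod_potential_difference[OF assms \<phi> \<tau>c pot] by blast
    qed
    then show ?thesis
      using f \<tau>c by (auto simp: tension_def)
  qed
  ultimately show ?thesis
    unfolding tension_continuous_def pow_eq_pow_iff_annihilates[symmetric] by blast
qed

theorem theorem16:
  fixes G :: "('a, 'b) pre_digraph" and H :: "('c, 'd) pre_digraph"
    and M :: "('m, 'x) monoid_scheme" and N :: "('n, 'y) monoid_scheme"
  assumes "fin_digraph G" and "fin_digraph H"
    and "fg_comm_group M" and "fg_comm_group N"
    and "group_n M = group_n N"
  shows "card (tension_continuous_maps M G H) = card (tension_continuous_maps N G H)"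
proof -
  have "comm_group M" "comm_group N"
    using assms(3,4) by (simp_all add: fg_comm_group_def)
  then have "tension_continuous M G H f \<longleftrightarrow> tension_continuous N G H f" for f
    by (simp only: tension_continuous_iff_annihilates[OF _ assms(2)]
        annihilates_cong_group_n[OF assms(3-5)])
  then show ?thesis
    by (simp add: tension_continuous_maps_def)
qed

end
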